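(* For every integer $k\geq 1$, there is a family $\mathcal{S}$ of line segments in the plane $\mathbb{R}^2$ with no three pairwise intersecting segments and with $\chi(\mathcal{S})>k$.
   Context: The intersection graph of a family of sets $\mathcal{F}$ is the graph with vertex set $\mathcal{F}$ in which two distinct members are adjacent if and only if they have nonempty intersection. A family is identified with its intersection graph, so $\chi(\mathcal{S})$ denotes the chromatic number of the intersection graph of $\mathcal{S}$, i.e. the minimum number of colors in an assignment of colors to the members of $\mathcal{S}$ such that any two distinct intersecting members get different colors. *)

theory Defs
  imports "HOL-Analysis.Analysis" "HOL-Library.Extended_Nat"
begin

text \<open>A graph is given by its vertex set and its adjacency relation.\<close>

definition intersection_adj :: "'a set \<Rightarrow> 'a set \<Rightarrow> bool" where
  "intersection_adj A B \<longleftrightarrow> A \<noteq> B \<and> A \<inter> B \<noteq> {}"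

definition proper_coloring :: "'v set \<Rightarrow> ('v \<Rightarrow> 'v \<Rightarrow> bool) \<Rightarrow> nat \<Rightarrow> ('v \<Rightarrow> nat) \<Rightarrow> bool" where
  "proper_coloring V adj n c \<longleftrightarrow>
     c ` V \<subseteq> {..<n} \<and> (\<forall>u\<in>V. \<forall>v\<in>V. adj u v \<longrightarrow> c u \<noteq> c v)"

text \<open>The value is \<open>\<infinity>\<close>, the infimum of the empty set, when no finite number of colors suffices.\<close>

definition chromatic_number :: "'v set \<Rightarrow> ('v \<Rightarrow> 'v \<Rightarrow> bool) \<Rightarrow> enat" where
  "chromatic_number V adj = Inf {enat n | n. \<exists>c. proper_coloring V adj n c}"

definition family_chromatic_number :: "'a set set \<Rightarrow> enat" where
  "family_chromatic_number F = chromatic_number F intersection_adj"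

definition is_line_segment :: "(real ^ 2) set \<Rightarrow> bool" where
  "is_line_segment s \<longleftrightarrow> (\<exists>a b. a \<noteq> b \<and> s = closed_segment a b)"

end

theory Submission
  imports Defs
begin

text \<open>
  The proof is an induction that yields a stronger statement: besides a triangle-free family of
  segments inside a box it builds a set of \<^emph>\<open>probes\<close>. A probe is a horizontal strip, unbounded to
  the right, whose leftmost part (its root) is free of segments; every segment that meets a probe
  crosses it from bottom to top, and the segments crossing a common probe are pairwise disjoint.
  The vertical ranges of distinct probes are disjoint.
  The invariant is that every proper coloring uses at least \<open>k\<close> colors on the segments crossing
  some probe. The empty family with one probe satisfies it for \<open>k = 0\<close>.

  For the step, every root receives its own copy, suitably shrunk, of a family with invariant \<open>k\<close>. For every
  probe \<open>q\<close> of the outer family and every probe \<open>w\<close> of the copy in the root of \<open>q\<close> one adds a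
  slanted segment \<open>diag q w\<close>. It runs inside the lower half of \<open>w\<close>, meets exactly the segments of
  the copy that cross \<open>w\<close>, and ends in the root of \<open>q\<close> to the right of the copy. As these segments
  are pairwise disjoint, no triangle arises. Two new probes replace \<open>w\<close>. The upper one passes above
  \<open>diag q w\<close>, and is crossed by the segments of the copy crossing \<open>w\<close> and by the outer segments
  crossing \<open>q\<close>. The lower one begins to the right of the copy, and is crossed by \<open>diag q w\<close> and by
  the outer segments crossing \<open>q\<close>. In a proper coloring, choose \<open>q\<close>, and then \<open>w\<close>, so that both sets of
  crossing segments have at least \<open>k\<close> colors. If the two color sets together have at least \<open>k + 1\<close>
  colors, the upper probe has the invariant for \<open>k + 1\<close>. Otherwise the two color sets coincide;
  the color of \<open>diag q w\<close> does not occur in them, and the lower probe has at least \<open>k + 1\<close> colors.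
\<close>

section \<open>Probes\<close>

text \<open>
  The probe with these four coordinates is the set of points with abscissa at least \<open>left\<close> and
  ordinate between \<open>pbot\<close> and \<open>ptop\<close>. Its root is cut off at the abscissa \<open>mouth\<close>. Families live in
  bounded boxes, so nothing is lost by leaving probes unbounded to the right.
\<close>

datatype probe = Probe (left: real) (mouth: real) (pbot: real) (ptop: real)

definition region :: "probe \<Rightarrow> (real ^ 2) set" where
  "region q = {p. left q \<le> p $ 1 \<and> pbot q \<le> p $ 2 \<and> p $ 2 \<le> ptop q}"

definition root_region :: "probe \<Rightarrow> (real ^ 2) set" where
  "root_region q = {p \<in> region q. p $ 1 \<le> mouth q}"

text \<open>
  A set crosses a probe if it avoids the root and reaches the two horizontal sides beyond the root.
\<close>

definition crosses :: "(real ^ 2) set \<Rightarrow> probe \<Rightarrow> bool" where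
  "crosses s q \<longleftrightarrow> s \<inter> root_region q = {} \<and>
     (\<exists>p\<in>s. mouth q < p $ 1 \<and> p $ 2 = pbot q) \<and> (\<exists>p\<in>s. mouth q < p $ 1 \<and> p $ 2 = ptop q)"

text \<open>The members of \<open>S\<close> that meet the probe; in an arrangement they all cross it.\<close>

definition pierced :: "(real ^ 2) set set \<Rightarrow> probe \<Rightarrow> (real ^ 2) set set" where
  "pierced S q = {s \<in> S. s \<inter> region q \<noteq> {}}"

text \<open>\<open>subprobe w q\<close>: both \<open>w\<close> and its root lie inside \<open>q\<close> and its root, respectively,
  and \<open>w\<close> is not degenerate.\<close>

definition subprobe :: "probe \<Rightarrow> probe \<Rightarrow> bool" where
  "subprobe w q \<longleftrightarrow> left q \<le> left w \<and> left w < mouth w \<and> mouth w \<le> mouth q \<and>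
     pbot q \<le> pbot w \<and> pbot w < ptop w \<and> ptop w \<le> ptop q"

lemma is_line_segment_convex: "is_line_segment s \<Longrightarrow> convex s"
  unfolding is_line_segment_def by auto

lemma convex_halfplane_right: "convex {p :: real ^ 2. m < p $ 1}"
  using convex_halfspace_gt[of m "axis 1 1 :: real ^ 2"] by (simp add: inner_axis')

text \<open>
  An affine function takes all intermediate values on a convex set. The half-plane keeps track of
  the fact that the point found lies beyond the mouth of a probe.
\<close>

lemma convex_intermediate_value:
  fixes s :: "(real ^ 2) set"
  assumes "convex s" "p \<in> s" "q \<in> s" "m < p $ 1" "m < q $ 1"
    and "\<alpha> * p $ 1 + \<beta> * p $ 2 \<le> t" "t \<le> \<alpha> * q $ 1 + \<beta> * q $ 2"
  shows "\<exists>r\<in>s. m < r $ 1 \<and> \<alpha> * r $ 1 + \<beta> * r $ 2 = t"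
proof -
  let ?s = "s \<inter> {r. m < r $ 1}"
  have "connected ?s"
    using assms(1) convex_halfplane_right by (intro convex_connected convex_Int)
  moreover have "vector [\<alpha>, \<beta>] \<bullet> r = \<alpha> * r $ 1 + \<beta> * r $ 2" for r :: "real ^ 2"
    by (simp add: inner_vec_def sum_2)
  ultimately show ?thesis
    using connected_ivt_hyperplane[of ?s p q "vector [\<alpha>, \<beta>]" t] assms by auto
qed

lemma region_subprobe: "subprobe w q \<Longrightarrow> region w \<subseteq> region q"
  unfolding subprobe_def region_def by auto

lemma root_region_subprobe: "subprobe w q \<Longrightarrow> root_region w \<subseteq> root_region q"
  unfolding subprobe_def region_def root_region_def by auto

lemma crosses_subprobe:
  assumes "convex s" "crosses s q" "subprobe w q"
  shows "crosses s w"
proof -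
  obtain a b where a: "a \<in> s" "mouth q < a $ 1" "a $ 2 = pbot q"
    and b: "b \<in> s" "mouth q < b $ 1" "b $ 2 = ptop q"
    using assms(2) unfolding crosses_def by auto
  have level: "\<exists>r\<in>s. mouth w < r $ 1 \<and> r $ 2 = t" if "pbot q \<le> t" "t \<le> ptop q" for t
    using convex_intermediate_value[OF assms(1), of a b "mouth q" 0 1 t] a b that assms(3)
    unfolding subprobe_def by force
  have "s \<inter> root_region w = {}"
    using assms(2) root_region_subprobe[OF assms(3)] unfolding crosses_def by auto
  then show ?thesis
    using level assms(3) unfolding crosses_def subprobe_def by auto
qed

lemma crosses_meets_region:
  "crosses s q \<Longrightarrow> left q < mouth q \<Longrightarrow> pbot q < ptop q \<Longrightarrow> s \<inter> region q \<noteq> {}"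
  unfolding crosses_def region_def by force

section \<open>Triangle-free families\<close>

definition triangle_free :: "'a set set \<Rightarrow> bool" where
  "triangle_free S \<longleftrightarrow> \<not> (\<exists>A\<in>S. \<exists>B\<in>S. \<exists>C\<in>S. A \<noteq> B \<and> B \<noteq> C \<and> A \<noteq> C \<and>
     A \<inter> B \<noteq> {} \<and> B \<inter> C \<noteq> {} \<and> A \<inter> C \<noteq> {})"

lemma triangle_freeI:
  assumes "\<And>A B C. \<lbrakk>A \<in> S; B \<in> S; C \<in> S; A \<noteq> B; B \<noteq> C; A \<noteq> C;
    A \<inter> B \<noteq> {}; B \<inter> C \<noteq> {}; A \<inter> C \<noteq> {}\<rbrakk> \<Longrightarrow> False"
  shows "triangle_free S"
  unfolding triangle_free_def using assms by blast

lemma triangle_freeD: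
  assumes "triangle_free S" "A \<in> S" "B \<in> S" "C \<in> S" "A \<noteq> B" "B \<noteq> C" "A \<noteq> C"
    and "A \<inter> B \<noteq> {}" "B \<inter> C \<noteq> {}" "A \<inter> C \<noteq> {}"
  shows False
  using assms(1) unfolding triangle_free_def by (elim notE) (intro bexI conjI; fact)

lemma triangle_free_UN:
  assumes free: "\<And>i. i \<in> I \<Longrightarrow> triangle_free (F i)"
    and apart: "\<And>i j A B. i \<in> I \<Longrightarrow> j \<in> I \<Longrightarrow> i \<noteq> j \<Longrightarrow> A \<in> F i \<Longrightarrow> B \<in> F j \<Longrightarrow> A \<inter> B = {}"
  shows "triangle_free (\<Union>i\<in>I. F i)"
proof (rule triangle_freeI)
  fix A B C assume "A \<in> (\<Union>i\<in>I. F i)" "B \<in> (\<Union>i\<in>I. F i)" "C \<in> (\<Union>i\<in>I. F i)"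
    and neq: "A \<noteq> B" "B \<noteq> C" "A \<noteq> C" and meet: "A \<inter> B \<noteq> {}" "B \<inter> C \<noteq> {}" "A \<inter> C \<noteq> {}"
  then obtain i j l where i: "i \<in> I" "A \<in> F i" and j: "j \<in> I" "B \<in> F j" and l: "l \<in> I" "C \<in> F l"
    by auto
  have "i = j" "i = l"
    using apart[OF i(1) j(1) _ i(2) j(2)] apart[OF i(1) l(1) _ i(2) l(2)] meet by auto
  then show False
    using triangle_freeD[OF free[OF i(1)] i(2) _ _ neq meet] j l by simp
qed

lemma triangle_free_Un:
  assumes "triangle_free S" "triangle_free T" "\<And>A B. A \<in> S \<Longrightarrow> B \<in> T \<Longrightarrow> A \<inter> B = {}"
  shows "triangle_free (S \<union> T)"
proof -
  have "triangle_free (\<Union>b\<in>UNIV. if b then S else T)"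
    using assms by (intro triangle_free_UN) (auto simp: Int_commute split: if_splits)
  then show ?thesis
    by (simp add: UNIV_bool Un_commute)
qed

lemma triangle_free_Un_independent:
  assumes "triangle_free S" "disjoint D"
    and "\<And>d. d \<in> D \<Longrightarrow> disjoint {s \<in> S. s \<inter> d \<noteq> {}}"
  shows "triangle_free (S \<union> D)"
proof (rule triangle_freeI)
  fix A B C assume mem: "A \<in> S \<union> D" "B \<in> S \<union> D" "C \<in> S \<union> D"
    and neq: "A \<noteq> B" "B \<noteq> C" "A \<noteq> C" and meet: "A \<inter> B \<noteq> {}" "B \<inter> C \<noteq> {}" "A \<inter> C \<noteq> {}"
  have one: "X \<notin> D \<or> Y \<notin> D" if "X \<noteq> Y" "X \<inter> Y \<noteq> {}" for X Y
    using disjointD[OF assms(2), of X Y] that by blast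
  have two: False
    if "X \<in> D" "Y \<in> S" "Z \<in> S" "Y \<inter> X \<noteq> {}" "Z \<inter> X \<noteq> {}" "Y \<inter> Z \<noteq> {}" "Y \<noteq> Z" for X Y Z
    using disjointD[OF assms(3)[OF that(1)], of Y Z] that by auto
  consider "A \<in> S" "B \<in> S" "C \<in> S" | "A \<in> D" "B \<in> S" "C \<in> S"
    | "B \<in> D" "A \<in> S" "C \<in> S" | "C \<in> D" "A \<in> S" "B \<in> S"
    using mem one[OF neq(1) meet(1)] one[OF neq(2) meet(2)] one[OF neq(3) meet(3)] by auto
  then show False
  proof cases
    case 1
    show ?thesis by (rule triangle_freeD[OF assms(1) 1 neq meet])
  next
    case 2
    show ?thesis using two[OF 2] neq meet by (simp add: Int_commute)
  next
    case 3
    show ?thesis using two[OF 3] neq meet by (simp add: Int_commute)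
  next
    case 4
    show ?thesis using two[OF 4] neq meet by (simp add: Int_commute)
  qed
qed

section \<open>Arrangements of segments and probes\<close>

definition open_box :: "real \<Rightarrow> real \<Rightarrow> real \<Rightarrow> real \<Rightarrow> (real ^ 2) set" where
  "open_box x0 x1 y0 y1 = {p. x0 < p $ 1 \<and> p $ 1 < x1 \<and> y0 < p $ 2 \<and> p $ 2 < y1}"

text \<open>
  The geometric part of the invariant, for a family \<open>S\<close> and a set \<open>Q\<close> of probes in an open box.
  Since all probes extend to the right side of the box, disjointness of probes means that their
  vertical ranges are disjoint.
\<close>

locale arrangement =
  fixes x0 x1 y0 y1 :: real and S :: "(real ^ 2) set set" and Q :: "probe set"
  assumes finite_segments: "finite S" and finite_probes: "finite Q"
    and segment: "s \<in> S \<Longrightarrow> is_line_segment s"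
    and in_box: "s \<in> S \<Longrightarrow> s \<subseteq> open_box x0 x1 y0 y1"
    and tri_free: "triangle_free S"
    and probe_bounds: "q \<in> Q \<Longrightarrow> x0 < left q \<and> left q < mouth q \<and> mouth q < x1 \<and>
           y0 < pbot q \<and> pbot q < ptop q \<and> ptop q < y1"
    and pierced_crosses: "q \<in> Q \<Longrightarrow> s \<in> pierced S q \<Longrightarrow> crosses s q"
    and disjoint_pierced: "q \<in> Q \<Longrightarrow> disjoint (pierced S q)"
    and probes_apart: "q \<in> Q \<Longrightarrow> q' \<in> Q \<Longrightarrow> q \<noteq> q' \<Longrightarrow> ptop q < pbot q' \<or> ptop q' < pbot q"
begin

lemma avoids_root: "s \<in> S \<Longrightarrow> q \<in> Q \<Longrightarrow> s \<inter> root_region q = {}"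
  using pierced_crosses[of q s] unfolding crosses_def pierced_def root_region_def by blast

lemma probes_same:
  assumes "q \<in> Q" "q' \<in> Q" "pbot q \<le> t" "t \<le> ptop q" "pbot q' \<le> t" "t \<le> ptop q'"
  shows "q = q'"
  using probes_apart[OF assms(1,2)] assms(3-) by linarith

end

text \<open>The chromatic part of the invariant; no bound is put on the number of colors.\<close>

definition forces_colors :: "nat \<Rightarrow> (real ^ 2) set set \<Rightarrow> probe set \<Rightarrow> bool" where
  "forces_colors k S Q \<longleftrightarrow>
     (\<forall>c :: (real ^ 2) set \<Rightarrow> nat.
        (\<forall>A\<in>S. \<forall>B\<in>S. intersection_adj A B \<longrightarrow> c A \<noteq> c B) \<longrightarrow>
        (\<exists>q\<in>Q. k \<le> card (c ` pierced S q)))"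

section \<open>The added segments and probes\<close>

text \<open>The copy in the root of \<open>q\<close> uses only the part of the root to the left of this abscissa.\<close>

definition halfway :: "probe \<Rightarrow> real" where
  "halfway q = (left q + mouth q) / 2"

text \<open>
  From the midpoint of the left side of \<open>w\<close> down to the bottom height of \<open>w\<close>, which is reached only
  at the mouth of \<open>q\<close>.
\<close>

definition diag :: "probe \<Rightarrow> probe \<Rightarrow> (real ^ 2) set" where
  "diag q w =
     closed_segment (vector [left w, (pbot w + ptop w) / 2]) (vector [mouth q, pbot w])"

definition upper :: "probe \<Rightarrow> probe" where
  "upper w = Probe (left w) (mouth w) ((pbot w + 3 * ptop w) / 4) (ptop w)"

text \<open>
  The top of the lower probe is the height of \<open>diag q w\<close> at the midpoint between \<open>halfway q\<close> and
  \<open>mouth q\<close>; the mouth lies halfway before that midpoint, so the root stays below \<open>diag q w\<close>.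
\<close>

definition lower :: "probe \<Rightarrow> probe \<Rightarrow> probe" where
  "lower q w = Probe (halfway q) ((3 * halfway q + mouth q) / 4) (pbot w)
     (pbot w + (ptop w - pbot w) * (mouth q - halfway q) / (4 * (mouth q - left w)))"

text \<open>A non-vertical segment is the graph of an affine function over an interval.\<close>

lemma mem_graph_segment_iff:
  fixes p :: "real ^ 2"
  assumes "a < b"
  shows "p \<in> closed_segment (vector [a, u]) (vector [b, v]) \<longleftrightarrow>
    a \<le> p $ 1 \<and> p $ 1 \<le> b \<and> (p $ 2 - v) * (b - a) = (u - v) * (b - p $ 1)"
proof
  assume "p \<in> closed_segment (vector [a, u]) (vector [b, v])"
  then obtain t where t: "0 \<le> t" "t \<le> 1"
    and p: "p $ 1 = (1 - t) * a + t * b" "p $ 2 = (1 - t) * u + t * v"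
    by (auto simp: closed_segment_def)
  have "p $ 1 - a = t * (b - a)" "b - p $ 1 = (1 - t) * (b - a)"
    unfolding p by (simp_all add: algebra_simps)
  moreover have "(p $ 2 - v) * (b - a) = (u - v) * (b - p $ 1)"
    unfolding p by (simp add: algebra_simps)
  ultimately show "a \<le> p $ 1 \<and> p $ 1 \<le> b \<and> (p $ 2 - v) * (b - a) = (u - v) * (b - p $ 1)"
    using t assms by (smt (verit) mult_nonneg_nonneg)
next
  assume r: "a \<le> p $ 1 \<and> p $ 1 \<le> b \<and> (p $ 2 - v) * (b - a) = (u - v) * (b - p $ 1)"
  define t where "t = (p $ 1 - a) / (b - a)"
  have t: "0 \<le> t" "t \<le> 1" "t * (b - a) = p $ 1 - a"
    using r assms by (auto simp: t_def field_simps)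
  have 1: "p $ 1 = (1 - t) * a + t * b"
    using t(3) by (simp add: algebra_simps)
  have "(p $ 2 - v) * (b - a) = (u - v) * (1 - t) * (b - a)"
    using r unfolding 1 by (simp add: algebra_simps)
  then have "p $ 2 - v = (u - v) * (1 - t)"
    using assms by simp
  then have 2: "p $ 2 = (1 - t) * u + t * v"
    by (simp add: algebra_simps)
  have "p = (1 - t) *\<^sub>R vector [a, u] + t *\<^sub>R vector [b, v]"
    using 1 2 by (simp add: vec_eq_iff forall_2)
  then show "p \<in> closed_segment (vector [a, u]) (vector [b, v])"
    using t by (auto simp: closed_segment_def)
qed

text \<open>The position of a probe \<open>w\<close> of the copy placed in the root of \<open>q\<close>.\<close>

locale nested_probe =
  fixes q w :: probe
  assumes horizontal: "left q < left w" "left w < mouth w" "mouth w < halfway q" "left q < mouth q"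
    and vertical: "pbot q < pbot w" "pbot w < ptop w" "ptop w < ptop q"
begin

lemma halfway_less: "halfway q < mouth q" "left q < halfway q"
  using horizontal unfolding halfway_def by auto

lemma left_less_mouth: "left w < mouth q"
  using horizontal halfway_less by linarith

lemma diag_iff:
  "p \<in> diag q w \<longleftrightarrow> left w \<le> p $ 1 \<and> p $ 1 \<le> mouth q \<and>
     2 * (p $ 2 - pbot w) * (mouth q - left w) = (ptop w - pbot w) * (mouth q - p $ 1)"
proof -
  have "(p $ 2 - pbot w) * (mouth q - left w) =
          ((pbot w + ptop w) / 2 - pbot w) * (mouth q - p $ 1) \<longleftrightarrow>
        2 * (p $ 2 - pbot w) * (mouth q - left w) = (ptop w - pbot w) * (mouth q - p $ 1)"
    by argo
  then show ?thesis
    unfolding diag_def mem_graph_segment_iff[OF left_less_mouth] by simp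
qed

lemma is_line_segment_diag: "is_line_segment (diag q w)"
proof -
  have "vector [left w, (pbot w + ptop w) / 2] \<noteq> (vector [mouth q, pbot w] :: real ^ 2)"
    using left_less_mouth by (metis less_irrefl vector_2(1))
  then show ?thesis
    unfolding is_line_segment_def diag_def by blast
qed

lemma diag_height:
  assumes "p \<in> diag q w"
  shows "pbot w \<le> p $ 2" "p $ 2 \<le> (pbot w + ptop w) / 2"
proof -
  have d: "mouth q - left w > 0" "ptop w - pbot w > 0"
    using left_less_mouth vertical by auto
  have p: "left w \<le> p $ 1" "p $ 1 \<le> mouth q"
    "2 * (p $ 2 - pbot w) * (mouth q - left w) = (ptop w - pbot w) * (mouth q - p $ 1)"
    using assms unfolding diag_iff by auto
  have "0 \<le> 2 * (p $ 2 - pbot w) * (mouth q - left w)"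
    unfolding p(3) using d p by simp
  then have "0 \<le> 2 * (p $ 2 - pbot w)"
    using d(1) by (simp add: zero_le_mult_iff)
  then show "pbot w \<le> p $ 2" by simp
  have "2 * (p $ 2 - pbot w) * (mouth q - left w) \<le> (ptop w - pbot w) * (mouth q - left w)"
    unfolding p(3) using d p by (intro mult_left_mono) auto
  then have "2 * (p $ 2 - pbot w) \<le> ptop w - pbot w"
    using d(1) by simp
  then show "p $ 2 \<le> (pbot w + ptop w) / 2" by simp
qed

lemma diag_subset_region: "diag q w \<subseteq> region w"
  using diag_height vertical diag_iff unfolding region_def by force

lemma diag_subset_root: "diag q w \<subseteq> root_region q"
  using diag_subset_region vertical horizontal
  unfolding root_region_def region_def diag_iff subset_iff by force

lemma diag_end: "vector [mouth q, pbot w] \<in> diag q w"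
  unfolding diag_def by simp

text \<open>
  The line through \<open>diag q w\<close> separates the two points at which \<open>s\<close> reaches the bottom and the top
  of \<open>w\<close>, and between these points \<open>s\<close> stays over the horizontal extent of \<open>diag q w\<close>.
\<close>

lemma crosses_meets_diag:
  assumes "convex s" "crosses s w" "s \<subseteq> {p. p $ 1 < halfway q}"
  shows "s \<inter> diag q w \<noteq> {}"
proof -
  obtain a b where a: "a \<in> s" "mouth w < a $ 1" "a $ 2 = pbot w"
    and b: "b \<in> s" "mouth w < b $ 1" "b $ 2 = ptop w"
    using assms(2) unfolding crosses_def by auto
  let ?d = "mouth q - left w" and ?h = "ptop w - pbot w"
  have ab: "a $ 1 < mouth q" "b $ 1 < mouth q" "left w < b $ 1"
    using a b assms(3) halfway_less horizontal by auto
  have h: "0 < ?h" "0 < ?d" using vertical left_less_mouth by auto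
  have "?h * a $ 1 \<le> ?h * mouth q"
    using ab h by (intro mult_left_mono) auto
  moreover have "?h * mouth q \<le> ?h * (b $ 1 + 2 * ?d)"
    using ab h by (intro mult_left_mono) auto
  ultimately have "?h * a $ 1 + 2 * ?d * a $ 2 \<le> ?h * mouth q + 2 * ?d * pbot w"
    "?h * mouth q + 2 * ?d * pbot w \<le> ?h * b $ 1 + 2 * ?d * b $ 2"
    unfolding a(3) b(3) by (simp_all add: algebra_simps)
  then obtain r where r: "r \<in> s" "mouth w < r $ 1"
    "?h * r $ 1 + 2 * ?d * r $ 2 = ?h * mouth q + 2 * ?d * pbot w"
    using convex_intermediate_value[OF assms(1) a(1) b(1) a(2) b(2)] by blast
  have "r \<in> diag q w"
    unfolding diag_iff using r assms(3) halfway_less horizontal by (auto simp: algebra_simps)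
  then show ?thesis using r(1) by auto
qed

lemma subprobe_upper: "subprobe (upper w) w" "subprobe (upper w) q"
  using horizontal vertical halfway_less unfolding subprobe_def upper_def by auto

lemma diag_avoids_upper: "diag q w \<inter> region (upper w) = {}"
  using diag_height(2) vertical unfolding region_def upper_def by force

lemma lower_sel:
  "left (lower q w) = halfway q" "mouth (lower q w) = (3 * halfway q + mouth q) / 4"
  "pbot (lower q w) = pbot w"
  unfolding lower_def by simp_all

lemma lower_top:
  "4 * (ptop (lower q w) - pbot w) * (mouth q - left w) =
     (ptop w - pbot w) * (mouth q - halfway q)"
proof -
  have "4 * (u / (4 * d)) * d = u" if "d \<noteq> 0" for u d :: real
    using that by simp
  then show ?thesis
    unfolding lower_def using left_less_mouth by (simp only: probe.sel add_diff_cancel_left')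
qed

lemma lower_height:
  "pbot w < ptop (lower q w)" "ptop (lower q w) < (3 * pbot w + ptop w) / 4"
proof -
  let ?d = "mouth q - left w" and ?e = "mouth q - halfway q" and ?h = "ptop w - pbot w"
  have d: "0 < ?e" "?e < ?d" "0 < ?d" and h: "0 < ?h"
    using vertical halfway_less horizontal by auto
  have "0 < ?h * ?e" "?h * ?e < ?h * ?d"
    using mult_pos_pos[OF h d(1)] mult_strict_left_mono[OF d(2) h] by blast+
  then have "0 < 4 * (ptop (lower q w) - pbot w) * ?d" "4 * (ptop (lower q w) - pbot w) * ?d < ?h * ?d"
    by (simp_all only: lower_top)
  then have "0 < 4 * (ptop (lower q w) - pbot w)" "4 * (ptop (lower q w) - pbot w) < ?h"
    using d(3) by (meson zero_less_mult_pos2, meson mult_less_cancel_right_pos)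
  then show "pbot w < ptop (lower q w)" "ptop (lower q w) < (3 * pbot w + ptop w) / 4"
    by simp_all
qed

lemma subprobe_lower: "subprobe (lower q w) q"
  using lower_height vertical halfway_less
  unfolding subprobe_def by (auto simp: lower_sel)

lemma crosses_diag_lower: "crosses (diag q w) (lower q w)"
proof -
  let ?m = "(halfway q + mouth q) / 2" and ?d = "mouth q - left w" and ?h = "ptop w - pbot w"
  have d: "0 < ?d" and h: "0 < ?h"
    using left_less_mouth vertical by auto
  let ?r = "vector [?m, ptop (lower q w)] :: real ^ 2"
  have half: "2 * (ptop (lower q w) - pbot w) * ?d = ?h * (mouth q - ?m)"
    using lower_top by argo
  have "?r \<in> diag q w"
    unfolding diag_iff using half horizontal halfway_less by simp
  moreover have "mouth (lower q w) < ?r $ 1"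
    using halfway_less by (simp add: lower_sel)
  moreover have "mouth (lower q w) < mouth q"
    using halfway_less by (simp add: lower_sel)
  moreover have "diag q w \<inter> root_region (lower q w) = {}"
  proof (rule ccontr)
    assume "diag q w \<inter> root_region (lower q w) \<noteq> {}"
    then obtain p where p: "p \<in> diag q w" "p $ 1 \<le> mouth (lower q w)" "p $ 2 \<le> ptop (lower q w)"
      unfolding root_region_def region_def by auto
    have "p $ 1 < ?m"
      using p(2) \<open>mouth (lower q w) < ?r $ 1\<close> by simp
    then have "?h * (mouth q - ?m) < ?h * (mouth q - p $ 1)"
      using h by simp
    also have "\<dots> = 2 * (p $ 2 - pbot w) * ?d"
      using p(1) unfolding diag_iff by simp
    also have "\<dots> \<le> 2 * (ptop (lower q w) - pbot w) * ?d"
      using p(3) d by (intro mult_right_mono) auto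
    finally show False
      using half by simp
  qed
  ultimately show ?thesis
    using diag_end unfolding crosses_def by (force simp: lower_sel)
qed

end

section \<open>The inductive step\<close>

text \<open>The arrangement \<open>T q\<close>, \<open>W q\<close> is the copy placed in the left half of the root of \<open>q\<close>.\<close>

locale refinement = outer: arrangement x0 x1 y0 y1 S Q
  for x0 x1 y0 y1 S Q +
  fixes T :: "probe \<Rightarrow> (real ^ 2) set set" and W :: "probe \<Rightarrow> probe set"
  assumes copy: "q \<in> Q \<Longrightarrow> arrangement (left q) (halfway q) (pbot q) (ptop q) (T q) (W q)"
begin

definition diags :: "probe \<Rightarrow> (real ^ 2) set set" where
  "diags q = diag q ` W q"

definition refined_segments :: "(real ^ 2) set set" where
  "refined_segments = S \<union> (\<Union>q\<in>Q. T q \<union> diags q)"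

definition refined_probes :: "probe set" where
  "refined_probes = (\<Union>q\<in>Q. \<Union>w\<in>W q. {upper w, lower q w})"

lemma nested: "q \<in> Q \<Longrightarrow> w \<in> W q \<Longrightarrow> nested_probe q w"
  using arrangement.probe_bounds[OF copy] outer.probe_bounds
  unfolding nested_probe_def by blast

lemma copy_subset_root: "q \<in> Q \<Longrightarrow> s \<in> T q \<Longrightarrow> s \<subseteq> root_region q"
  using arrangement.in_box[OF copy, of q s] outer.probe_bounds[of q]
  unfolding open_box_def root_region_def region_def halfway_def by force

lemma copy_left_of_halfway: "q \<in> Q \<Longrightarrow> s \<in> T q \<Longrightarrow> s \<subseteq> {p. p $ 1 < halfway q}"
  using arrangement.in_box[OF copy, of q s] unfolding open_box_def by auto

lemma added_subset_root: "q \<in> Q \<Longrightarrow> s \<in> T q \<union> diags q \<Longrightarrow> s \<subseteq> root_region q"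
  using copy_subset_root nested_probe.diag_subset_root nested unfolding diags_def by blast

lemma added_subset_region: "q \<in> Q \<Longrightarrow> s \<in> T q \<union> diags q \<Longrightarrow> s \<subseteq> region q"
  using added_subset_root[of q s] unfolding root_region_def by auto

lemma root_subset_box: "q \<in> Q \<Longrightarrow> root_region q \<subseteq> open_box x0 x1 y0 y1"
  using outer.probe_bounds[of q] unfolding open_box_def root_region_def region_def by auto

lemma regions_same:
  assumes "q \<in> Q" "q' \<in> Q" "region q \<inter> region q' \<noteq> {}"
  shows "q = q'"
  using assms outer.probes_same[of q q'] unfolding region_def by auto

lemma copy_regions_same:
  assumes "q \<in> Q" "w \<in> W q" "w' \<in> W q" "region w \<inter> region w' \<noteq> {}"
  shows "w = w'"
  using assms arrangement.probes_same[OF copy, of q w w'] unfolding region_def by auto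

lemma region_nested:
  assumes "q \<in> Q" "w \<in> W q"
  shows "region w \<subseteq> region q"
  using nested_probe.horizontal[OF nested[OF assms]] nested_probe.vertical[OF nested[OF assms]]
  unfolding region_def by auto

text \<open>The lower probe lies inside \<open>w\<close> but misses the copy, which lies to the left of \<open>halfway q\<close>.\<close>

lemma region_lower:
  assumes "q \<in> Q" "w \<in> W q"
  shows "region (lower q w) \<subseteq> region w" "region (lower q w) \<inter> {p. p $ 1 < halfway q} = {}"
proof -
  interpret nested_probe q w using nested[OF assms] .
  show "region (lower q w) \<subseteq> region w"
    using lower_height vertical horizontal unfolding region_def by (auto simp: lower_sel)
  show "region (lower q w) \<inter> {p. p $ 1 < halfway q} = {}"
    unfolding region_def by (auto simp: lower_sel)
qed

lemma copy_meets_diag: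
  assumes "q \<in> Q" "w \<in> W q" "s \<in> T q"
  shows "s \<inter> diag q w \<noteq> {} \<longleftrightarrow> s \<in> pierced (T q) w"
proof
  show "s \<inter> diag q w \<noteq> {} \<Longrightarrow> s \<in> pierced (T q) w"
    using nested_probe.diag_subset_region[OF nested] assms unfolding pierced_def by blast
  show "s \<in> pierced (T q) w \<Longrightarrow> s \<inter> diag q w \<noteq> {}"
    using assms nested_probe.crosses_meets_diag[OF nested] copy_left_of_halfway
      arrangement.pierced_crosses[OF copy] arrangement.segment[OF copy] is_line_segment_convex
    by meson
qed

lemma triangle_free_refined: "triangle_free refined_segments"
  unfolding refined_segments_def
proof (rule triangle_free_Un[OF outer.tri_free triangle_free_UN])
  fix A B assume "A \<in> S" "B \<in> (\<Union>q\<in>Q. T q \<union> diags q)"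
  then show "A \<inter> B = {}"
    using outer.avoids_root added_subset_root by blast
next
  fix q assume q: "q \<in> Q"
  show "triangle_free (T q \<union> diags q)"
  proof (rule triangle_free_Un_independent)
    show "triangle_free (T q)"
      using arrangement.tri_free[OF copy[OF q]] .
    show "disjoint (diags q)"
      using copy_regions_same[OF q] nested_probe.diag_subset_region[OF nested[OF q]]
      unfolding diags_def disjoint_def by blast
    fix d assume "d \<in> diags q"
    then obtain w where "w \<in> W q" "d = diag q w"
      unfolding diags_def by auto
    then have "{s \<in> T q. s \<inter> d \<noteq> {}} = pierced (T q) w"
      using copy_meets_diag[OF q] unfolding pierced_def by blast
    then show "disjoint {s \<in> T q. s \<inter> d \<noteq> {}}"
      using arrangement.disjoint_pierced[OF copy[OF q] \<open>w \<in> W q\<close>] by simp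
  qed
next
  fix q q' A B
  assume q: "q \<in> Q" "q' \<in> Q" "q \<noteq> q'" and "A \<in> T q \<union> diags q" "B \<in> T q' \<union> diags q'"
  then have "A \<subseteq> region q" "B \<subseteq> region q'"
    using added_subset_region by blast+
  then show "A \<inter> B = {}"
    using regions_same[OF q(1,2)] q(3) by auto
qed

lemma refined_meeting_cases:
  assumes "q \<in> Q" "w \<in> W q" "s \<in> refined_segments" "s \<inter> region w \<noteq> {}"
  shows "s \<in> pierced S q \<or> s \<in> pierced (T q) w \<or> s = diag q w"
proof -
  have q': "s \<in> T q \<union> diags q" if "q' \<in> Q" "s \<in> T q' \<union> diags q'" for q'
  proof -
    have "s \<subseteq> region q'"
      by (rule added_subset_region[OF that])
    then have "region q \<inter> region q' \<noteq> {}"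
      using assms(4) region_nested[OF assms(1,2)] by auto
    then show ?thesis
      using regions_same[OF assms(1) that(1)] that(2) by simp
  qed
  have "s = diag q w" if "s \<in> diags q"
    using that assms(4) copy_regions_same[OF assms(1,2)]
      nested_probe.diag_subset_region[OF nested[OF assms(1)]] unfolding diags_def by blast
  moreover have "s \<in> pierced S q" if "s \<in> S"
    using that assms(4) region_nested[OF assms(1,2)] unfolding pierced_def by blast
  ultimately show ?thesis
    using q' assms(3,4) unfolding refined_segments_def pierced_def by blast
qed

lemma pierced_upper:
  assumes "q \<in> Q" "w \<in> W q"
  shows "pierced refined_segments (upper w) = pierced S q \<union> pierced (T q) w"
    and "s \<in> pierced S q \<union> pierced (T q) w \<Longrightarrow> crosses s (upper w)"
proof -
  interpret nested_probe q w using nested[OF assms] .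
  show c: "crosses s (upper w)" if "s \<in> pierced S q \<union> pierced (T q) w" for s
    using that
  proof
    assume s: "s \<in> pierced S q"
    then show ?thesis
      using crosses_subprobe[OF _ _ subprobe_upper(2)] outer.pierced_crosses[OF assms(1)]
        outer.segment is_line_segment_convex unfolding pierced_def by blast
  next
    assume s: "s \<in> pierced (T q) w"
    then show ?thesis
      using crosses_subprobe[OF _ _ subprobe_upper(1)] assms
        arrangement.pierced_crosses[OF copy] arrangement.segment[OF copy] is_line_segment_convex
      unfolding pierced_def by blast
  qed
  have "s \<in> pierced refined_segments (upper w)" if "s \<in> pierced S q \<union> pierced (T q) w" for s
    using crosses_meets_region[OF c[OF that]] that assms subprobe_upper(1)
    unfolding pierced_def refined_segments_def subprobe_def by blast
  moreover have "s \<in> pierced S q \<union> pierced (T q) w"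
    if "s \<in> pierced refined_segments (upper w)" for s
    using that refined_meeting_cases[OF assms, of s] region_subprobe[OF subprobe_upper(1)]
      diag_avoids_upper unfolding pierced_def[of refined_segments] by blast
  ultimately show "pierced refined_segments (upper w) = pierced S q \<union> pierced (T q) w"
    by blast
qed

lemma pierced_lower:
  assumes "q \<in> Q" "w \<in> W q"
  shows "pierced refined_segments (lower q w) = insert (diag q w) (pierced S q)"
    and "s \<in> insert (diag q w) (pierced S q) \<Longrightarrow> crosses s (lower q w)"
proof -
  interpret nested_probe q w using nested[OF assms] .
  show c: "crosses s (lower q w)" if "s \<in> insert (diag q w) (pierced S q)" for s
    using that
  proof
    assume "s = diag q w"
    then show ?thesis using crosses_diag_lower by simp
  next
    assume s: "s \<in> pierced S q"
    then show ?thesis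
      using crosses_subprobe[OF _ _ subprobe_lower] outer.pierced_crosses[OF assms(1)]
        outer.segment is_line_segment_convex unfolding pierced_def by blast
  qed
  have "s \<in> pierced refined_segments (lower q w)" if "s \<in> insert (diag q w) (pierced S q)" for s
    using crosses_meets_region[OF c[OF that]] that assms subprobe_lower
    unfolding pierced_def refined_segments_def subprobe_def diags_def by blast
  moreover have "s \<in> insert (diag q w) (pierced S q)"
    if "s \<in> pierced refined_segments (lower q w)" for s
    using that refined_meeting_cases[OF assms, of s] region_lower[OF assms]
      copy_left_of_halfway[OF assms(1), of s] unfolding pierced_def[of refined_segments]
      pierced_def[of "T q"] by blast
  ultimately show "pierced refined_segments (lower q w) = insert (diag q w) (pierced S q)"
    by blast
qed

lemma refined_probe_cases:
  assumes "r \<in> refined_probes"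
  obtains q w where "q \<in> Q" "w \<in> W q" "r = upper w \<or> r = lower q w"
  using assms unfolding refined_probes_def by blast

lemma new_probe_range:
  assumes "q \<in> Q" "w \<in> W q" "r = upper w \<or> r = lower q w"
  shows "pbot w \<le> pbot r" "pbot r < ptop r" "ptop r \<le> ptop w"
proof -
  interpret nested_probe q w using nested[OF assms(1,2)] .
  show "pbot w \<le> pbot r" "pbot r < ptop r" "ptop r \<le> ptop w"
    using assms(3) vertical lower_height by (elim disjE; simp add: upper_def lower_sel)+
qed

lemma arrangement_refined: "arrangement x0 x1 y0 y1 refined_segments refined_probes"
proof
  have fin: "finite (T q)" "finite (W q)" if "q \<in> Q" for q
    using arrangement.finite_segments[OF copy[OF that]]
      arrangement.finite_probes[OF copy[OF that]] by auto
  show "finite refined_segments" "finite refined_probes"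
    unfolding refined_segments_def refined_probes_def diags_def
    using fin outer.finite_segments outer.finite_probes by auto
  show "triangle_free refined_segments"
    by (rule triangle_free_refined)
next
  fix s assume s: "s \<in> refined_segments"
  then show "is_line_segment s"
    using outer.segment arrangement.segment[OF copy] nested_probe.is_line_segment_diag[OF nested]
    unfolding refined_segments_def diags_def by blast
  show "s \<subseteq> open_box x0 x1 y0 y1"
    using s outer.in_box added_subset_root root_subset_box unfolding refined_segments_def
    by blast
next
  fix r assume "r \<in> refined_probes"
  then obtain q w where q: "q \<in> Q" and w: "w \<in> W q" and r: "r = upper w \<or> r = lower q w"
    by (rule refined_probe_cases)
  interpret nested_probe q w using nested[OF q w] .
  have "subprobe r q"
    using r subprobe_upper subprobe_lower by auto
  then show "x0 < left r \<and> left r < mouth r \<and> mouth r < x1 \<and>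
      y0 < pbot r \<and> pbot r < ptop r \<and> ptop r < y1"
    using outer.probe_bounds[OF q] unfolding subprobe_def by linarith
  show "crosses s r" if "s \<in> pierced refined_segments r" for s
    using r
  proof
    assume "r = upper w"
    then show ?thesis
      using pierced_upper(2)[OF q w, of s] that unfolding pierced_upper(1)[OF q w, symmetric] by simp
  next
    assume "r = lower q w"
    then show ?thesis
      using pierced_lower(2)[OF q w, of s] that unfolding pierced_lower(1)[OF q w, symmetric] by simp
  qed
  have outer_root: "s \<inter> t = {}" if "s \<in> pierced S q" "t \<subseteq> root_region q" for s t
    using outer.avoids_root[of s q] that q unfolding pierced_def by blast
  show "disjoint (pierced refined_segments r)"
    using r
  proof
    assume "r = upper w"
    moreover have "disjoint (pierced S q \<union> pierced (T q) w)"
    proof (rule disjoint_union)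
      show "disjoint (pierced S q)"
        by (rule outer.disjoint_pierced[OF q])
      show "disjoint (pierced (T q) w)"
        by (rule arrangement.disjoint_pierced[OF copy[OF q] w])
      have "s \<inter> t = {}" if "s \<in> pierced S q" "t \<in> pierced (T q) w" for s t
        using outer_root[OF that(1) copy_subset_root[OF q, of t]] that(2)
        unfolding pierced_def[of "T q"] by simp
      then show "\<Union> (pierced S q) \<inter> \<Union> (pierced (T q) w) = {}"
        by blast
    qed
    ultimately show ?thesis
      using pierced_upper(1)[OF q w] by simp
  next
    assume "r = lower q w"
    moreover have "disjoint (insert (diag q w) (pierced S q))"
    proof (rule pairwise_insert[THEN iffD2], intro conjI allI impI)
      show "disjoint (pierced S q)"
        by (rule outer.disjoint_pierced[OF q])
      fix s assume "s \<in> pierced S q \<and> s \<noteq> diag q w"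
      then have "s \<inter> diag q w = {}"
        using outer_root[OF _ diag_subset_root] by blast
      then show "disjnt (diag q w) s" "disjnt s (diag q w)"
        unfolding disjnt_def by blast+
    qed
    ultimately show ?thesis
      using pierced_lower(1)[OF q w] by simp
  qed
next
  fix r r' assume "r \<in> refined_probes" "r' \<in> refined_probes" "r \<noteq> r'"
  then obtain q w q' w' where q: "q \<in> Q" "w \<in> W q" "r = upper w \<or> r = lower q w"
    and q': "q' \<in> Q" "w' \<in> W q'" "r' = upper w' \<or> r' = lower q' w'"
    by (metis refined_probe_cases)
  interpret n: nested_probe q w using nested[OF q(1,2)] .
  interpret n': nested_probe q' w' using nested[OF q'(1,2)] .
  note ranges = new_probe_range[OF q] new_probe_range[OF q'] n.vertical n'.vertical
  show "ptop r < pbot r' \<or> ptop r' < pbot r"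
  proof (cases "q = q'")
    case False
    then show ?thesis
      using outer.probes_apart[OF q(1) q'(1)] ranges by linarith
  next
    case qq: True
    show ?thesis
    proof (cases "w = w'")
      case False
      then show ?thesis
        using arrangement.probes_apart[OF copy[OF q(1)] q(2), of w'] q'(2) qq ranges
        by (smt (verit))
    next
      case True
      have "ptop (lower q w) < pbot (upper w)"
        using n.lower_height n.vertical by (simp add: upper_def)
      then show ?thesis
        using True qq q(3) q'(3) \<open>r \<noteq> r'\<close> by auto
    qed
  qed
qed

lemma forces_colors_refined:
  assumes outer_colors: "forces_colors k S Q"
    and copy_colors: "\<And>q. q \<in> Q \<Longrightarrow> forces_colors k (T q) (W q)"
  shows "forces_colors (Suc k) refined_segments refined_probes"
  unfolding forces_colors_def
proof (intro allI impI)
  fix c :: "(real ^ 2) set \<Rightarrow> nat"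
  assume c: "\<forall>A\<in>refined_segments. \<forall>B\<in>refined_segments. intersection_adj A B \<longrightarrow> c A \<noteq> c B"
  have "S \<subseteq> refined_segments"
    unfolding refined_segments_def by auto
  then obtain q where q: "q \<in> Q" and kq: "k \<le> card (c ` pierced S q)"
    using outer_colors c unfolding forces_colors_def by blast
  have Tq: "T q \<subseteq> refined_segments"
    using q unfolding refined_segments_def by auto
  then obtain w where w: "w \<in> W q" and kw: "k \<le> card (c ` pierced (T q) w)"
    using copy_colors[OF q] c unfolding forces_colors_def by blast
  interpret nested_probe q w using nested[OF q w] .
  let ?A = "c ` pierced S q" and ?B = "c ` pierced (T q) w"
  have fin: "finite ?A" "finite ?B"
    using outer.finite_segments arrangement.finite_segments[OF copy[OF q]]
    unfolding pierced_def by auto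
  have probes: "upper w \<in> refined_probes" "lower q w \<in> refined_probes"
    using q w unfolding refined_probes_def by auto
  show "\<exists>r\<in>refined_probes. Suc k \<le> card (c ` pierced refined_segments r)"
  proof (cases "Suc k \<le> card (?A \<union> ?B)")
    case True
    then show ?thesis
      using probes(1) pierced_upper(1)[OF q w] by (metis image_Un)
  next
    case False
    then have "card (?A \<union> ?B) \<le> card ?A" "card (?A \<union> ?B) \<le> card ?B"
      using kq kw by auto
    then have "?A \<union> ?B = ?A" "?A \<union> ?B = ?B"
      using fin by (metis card_seteq finite_UnI Un_upper1, metis card_seteq finite_UnI Un_upper2)
    then have AB: "?A = ?B" by simp
    have "c (diag q w) \<noteq> c s" if s: "s \<in> pierced (T q) w" for s
    proof -
      have sT: "s \<in> T q" using s unfolding pierced_def by simp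
      have "diag q w \<noteq> s"
        using diag_end halfway_less copy_left_of_halfway[OF q sT] by auto
      moreover have "diag q w \<inter> s \<noteq> {}"
        using copy_meets_diag[OF q w sT] s by blast
      moreover have "diag q w \<in> refined_segments"
        using q w unfolding refined_segments_def diags_def by blast
      ultimately show ?thesis
        using c sT Tq unfolding intersection_adj_def by blast
    qed
    then have "c (diag q w) \<notin> ?A"
      unfolding AB by blast
    then have "Suc k \<le> card (insert (c (diag q w)) ?A)"
      using fin kq by simp
    then show ?thesis
      using probes(2) pierced_lower(1)[OF q w] by (metis image_insert)
  qed
qed

end

lemma arrangement_forcing_colors:
  assumes "x0 < x1" "y0 < y1"
  shows "\<exists>S Q. arrangement x0 x1 y0 y1 S Q \<and> forces_colors k S Q"
  using assms
proof (induction k arbitrary: x0 x1 y0 y1)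
  case 0
  \<comment> \<open>Any probe inside the box would do.\<close>
  let ?q = "Probe ((2 * x0 + x1) / 3) ((x0 + 2 * x1) / 3) ((2 * y0 + y1) / 3) ((y0 + 2 * y1) / 3)"
  have "arrangement x0 x1 y0 y1 {} {?q}"
    using 0 by unfold_locales (auto simp: triangle_free_def pierced_def)
  moreover have "forces_colors 0 {} {?q}"
    unfolding forces_colors_def by simp
  ultimately show ?case by blast
next
  case (Suc k)
  obtain S Q where SQ: "arrangement x0 x1 y0 y1 S Q" "forces_colors k S Q"
    using Suc.IH[OF Suc.prems] by blast
  have "\<exists>S' Q'. arrangement (left q) (halfway q) (pbot q) (ptop q) S' Q' \<and> forces_colors k S' Q'"
    if "q \<in> Q" for q
    using arrangement.probe_bounds[OF SQ(1) that] by (intro Suc.IH) (auto simp: halfway_def)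
  then obtain T W where TW:
    "\<And>q. q \<in> Q \<Longrightarrow> arrangement (left q) (halfway q) (pbot q) (ptop q) (T q) (W q)"
    "\<And>q. q \<in> Q \<Longrightarrow> forces_colors k (T q) (W q)"
    by metis
  interpret refinement x0 x1 y0 y1 S Q T W
    using SQ(1) TW(1) by (simp add: refinement_def refinement_axioms_def)
  show ?case
    using arrangement_refined forces_colors_refined[OF SQ(2) TW(2)] by blast
qed

lemma forces_colors_chromatic:
  assumes "forces_colors (Suc k) S Q"
  shows "family_chromatic_number S > enat k"
proof -
  have "Suc k \<le> n" if coloring: "proper_coloring S intersection_adj n c" for n c
  proof -
    have "\<forall>A\<in>S. \<forall>B\<in>S. intersection_adj A B \<longrightarrow> c A \<noteq> c B"
      using coloring unfolding proper_coloring_def by (rule conjunct2)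
    then obtain q where "Suc k \<le> card (c ` pierced S q)"
      using assms[unfolded forces_colors_def, rule_format, of c] by auto
    also have "\<dots> \<le> card {..<n}"
      using coloring unfolding proper_coloring_def pierced_def by (intro card_mono) auto
    finally show ?thesis by simp
  qed
  then have "enat (Suc k) \<le> family_chromatic_number S"
    unfolding family_chromatic_number_def chromatic_number_def by (intro Inf_greatest) auto
  then show ?thesis
    by (simp add: Suc_ile_eq)
qed

theorem theorem1:
  fixes k :: nat
  assumes "k \<ge> 1"
  shows "\<exists>S :: (real ^ 2) set set.
           (\<forall>s\<in>S. is_line_segment s) \<and>
           \<not> (\<exists>A\<in>S. \<exists>B\<in>S. \<exists>C\<in>S. A \<noteq> B \<and> B \<noteq> C \<and> A \<noteq> C \<and>
                A \<inter> B \<noteq> {} \<and> B \<inter> C \<noteq> {} \<and> A \<inter> C \<noteq> {}) \<and>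
           family_chromatic_number S > enat k"
proof -
  obtain S Q where "arrangement 0 1 0 1 S Q" and colors: "forces_colors (Suc k) S Q"
    using arrangement_forcing_colors[of 0 1 0 1 "Suc k"] by auto
  then interpret arrangement 0 1 0 1 S Q by simp
  show ?thesis
    using segment tri_free[unfolded triangle_free_def] forces_colors_chromatic[OF colors]
    by (intro exI[of _ S] conjI ballI)
qed

end
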